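(* For any $\varepsilon\in(0,1/4)$ (and a suitably chosen constant $c$), the Sequential Truncated-Pivot algorithm (described in the context) is a $(3+\varepsilon)$-approximation algorithm to the correlation clustering problem, the guarantee holding in expectation: the expected cost of its output is at most $(3+\varepsilon)\cdot\mathrm{OPT}(G)$.
   Context: Correlation clustering: input is a simple undirected graph $G=(V,E^+)$ on $n$ nodes (positive edges); distinct non-adjacent pairs are negative. The cost of a partition of $V$ into clusters is the number of positive edges between different clusters plus the number of negative pairs within a cluster; $\mathrm{OPT}(G)$ is the minimum cost. $\deg(u)$ is the degree of $u$ in $G$ (fixed throughout). Sequential Truncated-Pivot: all nodes start active. Pick a uniformly random permutation $\pi:V\to\{1,\dots,n\}$. For $i=1,2,\dots,n$: let $\ell_i=\frac{c}{\varepsilon}\cdot\frac{n\log n}{i}$ and let $u$ be the node with $\pi_u=i$; first, every active node $v$ with $\deg(v)\ge\ell_i$ becomes inactive and forms a singleton cluster; then, if $u$ is still active, create a pivot cluster consisting of $u$ and all its currently active neighbors, and make all nodes of this cluster inactive.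
   Formalization: The bound is proved for graphs with OPT(G) > 0; for OPT(G) = 0 it fails for every fixed c: with a large m-clique plus m isolated nodes, the isolated nodes may come first and the clique is then split into singletons, so the expected cost is positive. *)

theory Defs
  imports "HOL-Probability.Probability"
begin

section \<open>Correlation clustering\<close>

text \<open>The positive edges are two-element sets of nodes.\<close>

definition pairs :: "'a set \<Rightarrow> 'a set set" where
  "pairs V = {e. e \<subseteq> V \<and> card e = 2}"

definition simple_graph :: "'a set \<Rightarrow> 'a set set \<Rightarrow> bool" where
  "simple_graph V E \<longleftrightarrow> finite V \<and> E \<subseteq> pairs V"

definition neighbors :: "'a set set \<Rightarrow> 'a \<Rightarrow> 'a set" where
  "neighbors E u = {v. {u, v} \<in> E}"

definition degree :: "'a set set \<Rightarrow> 'a \<Rightarrow> nat" where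
  "degree E u = card (neighbors E u)"

definition cost :: "'a set \<Rightarrow> 'a set set \<Rightarrow> 'a set set \<Rightarrow> nat" where
  "cost V E P =
     card {e \<in> E. \<not> (\<exists>C\<in>P. e \<subseteq> C)} + card {e \<in> pairs V - E. \<exists>C\<in>P. e \<subseteq> C}"

definition OPT :: "'a set \<Rightarrow> 'a set set \<Rightarrow> nat" where
  "OPT V E = Min (cost V E ` {P. partition_on V P})"

section \<open>Sequential Truncated-Pivot\<close>

definition orderings :: "'a set \<Rightarrow> ('a \<Rightarrow> nat) set" where
  "orderings V = {\<pi> \<in> V \<rightarrow>\<^sub>E {1..card V}. bij_betw \<pi> V {1..card V}}"

text \<open>The base of the logarithm only rescales the constant \<open>c\<close>.\<close>

definition threshold :: "real \<Rightarrow> real \<Rightarrow> nat \<Rightarrow> nat \<Rightarrow> real" where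
  "threshold c \<epsilon> n i = c / \<epsilon> * (real n * ln (real n) / real i)"

text \<open>A state consists of the set of active nodes and the set of clusters formed so far.\<close>

type_synonym 'a state = "'a set \<times> 'a set set"

definition truncate :: "'a set set \<Rightarrow> real \<Rightarrow> 'a state \<Rightarrow> 'a state" where
  "truncate E l = (\<lambda>(A, P).
     let H = {v \<in> A. real (degree E v) \<ge> l} in (A - H, P \<union> (\<lambda>v. {v}) ` H))"

definition pivot :: "'a set set \<Rightarrow> 'a \<Rightarrow> 'a state \<Rightarrow> 'a state" where
  "pivot E u = (\<lambda>(A, P).
     if u \<in> A then let C = insert u (neighbors E u \<inter> A) in (A - C, insert C P) else (A, P))"

fun run :: "real \<Rightarrow> real \<Rightarrow> 'a set \<Rightarrow> 'a set set \<Rightarrow> ('a \<Rightarrow> nat) \<Rightarrow> nat \<Rightarrow> 'a state" where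
  "run c \<epsilon> V E \<pi> 0 = (V, {})"
| "run c \<epsilon> V E \<pi> (Suc i) =
     pivot E (inv_into V \<pi> (Suc i))
       (truncate E (threshold c \<epsilon> (card V) (Suc i)) (run c \<epsilon> V E \<pi> i))"

definition truncated_pivot ::
    "real \<Rightarrow> real \<Rightarrow> 'a set \<Rightarrow> 'a set set \<Rightarrow> ('a \<Rightarrow> nat) \<Rightarrow> 'a set set" where
  "truncated_pivot c \<epsilon> V E \<pi> = snd (run c \<epsilon> V E \<pi> (card V))"

definition expected_cost :: "real \<Rightarrow> real \<Rightarrow> 'a set \<Rightarrow> 'a set set \<Rightarrow> real" where
  "expected_cost c \<epsilon> V E =
     measure_pmf.expectation (pmf_of_set (orderings V))
       (\<lambda>\<pi>. real (cost V E (truncated_pivot c \<epsilon> V E \<pi>)))"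

text \<open>
  If \<open>OPT V E = 0\<close> (a disjoint union of cliques), no multiplicative guarantee can hold: for any
  fixed \<open>c, \<epsilon> > 0\<close> and large \<open>m\<close>, take an \<open>m\<close>-clique and \<open>m\<close> isolated nodes. With positive
  probability the isolated nodes come first, and since \<open>threshold c \<epsilon> (2 * m) m \<le> m - 1\<close> the whole
  clique is then split into singletons. So the approximation ratio is only considered for graphs
  with \<open>OPT V E > 0\<close>.
\<close>

section \<open>The definitions are meaningful\<close>

lemma truncate_partition:
  assumes "truncate E l (A, P) = (A', P')" "A \<subseteq> V" "partition_on (V - A) P"
  shows "A' \<subseteq> A \<and> partition_on (V - A') P'"
proof -
  define H where "H = {v \<in> A. real (degree E v) \<ge> l}"
  have eq: "A' = A - H" "P' = P \<union> (\<lambda>v. {v}) ` H"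
    using assms(1) by (auto simp: truncate_def H_def Let_def)
  have H: "H \<subseteq> A" by (auto simp: H_def)
  have U: "\<Union>P = V - A" and D: "disjoint P" and N: "{} \<notin> P"
    using assms(3) by (auto simp: partition_on_def)
  have "\<Union>P' = V - A'" using U H assms(2) by (auto simp: eq)
  moreover have "disjoint P'"
    unfolding eq
  proof (rule disjoint_union[OF D])
    show "disjoint ((\<lambda>v. {v}) ` H)" by (auto simp: disjoint_def)
    show "\<Union>P \<inter> \<Union>((\<lambda>v. {v}) ` H) = {}" using U H by auto
  qed
  moreover have "{} \<notin> P'" using N by (auto simp: eq)
  moreover have "A' \<subseteq> A" by (auto simp: eq)
  ultimately show ?thesis by (simp add: partition_on_def)
qed

lemma pivot_partition:
  assumes "pivot E u (A, P) = (A', P')" "A \<subseteq> V" "partition_on (V - A) P"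
  shows "A' \<subseteq> A - {u} \<and> partition_on (V - A') P'"
proof (cases "u \<in> A")
  case False
  then show ?thesis using assms by (auto simp: pivot_def)
next
  case True
  define C where "C = insert u (neighbors E u \<inter> A)"
  have eq: "A' = A - C" "P' = insert C P"
    using assms(1) True by (auto simp: pivot_def C_def Let_def)
  have C: "C \<subseteq> A" "u \<in> C" using True by (auto simp: C_def)
  have U: "\<Union>P = V - A" and D: "disjoint P" and N: "{} \<notin> P"
    using assms(3) by (auto simp: partition_on_def)
  have "\<Union>P' = V - A'" using U C assms(2) by (auto simp: eq)
  moreover have "disjoint P'"
    unfolding eq
  proof (subst insert_is_Un, subst Un_commute, rule disjoint_union[OF D])
    show "disjoint {C}" by (simp add: disjoint_def)
    show "\<Union>P \<inter> \<Union>{C} = {}" using U C by auto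
  qed
  moreover have "{} \<notin> P'" using N C by (auto simp: eq)
  moreover have "A' \<subseteq> A - {u}" using C by (auto simp: eq)
  ultimately show ?thesis by (simp add: partition_on_def)
qed

lemma run_partition:
  assumes "run c \<epsilon> V E \<pi> i = (A, P)"
  shows "A \<subseteq> V - inv_into V \<pi> ` {1..i} \<and> partition_on (V - A) P"
  using assms
proof (induction i arbitrary: A P)
  case 0
  then show ?case by (auto simp: partition_on_def)
next
  case (Suc i)
  obtain A0 P0 where 0: "run c \<epsilon> V E \<pi> i = (A0, P0)" by fastforce
  obtain A1 P1 where
    1: "truncate E (threshold c \<epsilon> (card V) (Suc i)) (A0, P0) = (A1, P1)" by fastforce
  have 2: "pivot E (inv_into V \<pi> (Suc i)) (A1, P1) = (A, P)"
    using Suc.prems 0 1 by simp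
  have A0: "A0 \<subseteq> V - inv_into V \<pi> ` {1..i}" "partition_on (V - A0) P0"
    using Suc.IH[OF 0] by auto
  have A1: "A1 \<subseteq> A0" "partition_on (V - A1) P1"
    using truncate_partition[OF 1 _ A0(2)] A0(1) by auto
  have "A \<subseteq> A1 - {inv_into V \<pi> (Suc i)}" "partition_on (V - A) P"
    using pivot_partition[OF 2 _ A1(2)] A1(1) A0(1) by auto
  moreover have "{1..Suc i} = insert (Suc i) {1..i}" by auto
  ultimately show ?case using A0(1) A1(1) by auto
qed

lemma partition_on_truncated_pivot:
  assumes "\<pi> \<in> orderings V"
  shows "partition_on V (truncated_pivot c \<epsilon> V E \<pi>)"
proof -
  have bij: "bij_betw \<pi> V {1..card V}" using assms by (simp add: orderings_def)
  obtain A P where r: "run c \<epsilon> V E \<pi> (card V) = (A, P)" by fastforce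
  have "inv_into V \<pi> ` {1..card V} = V"
    using bij_betw_inv_into[OF bij] by (simp add: bij_betw_def)
  then have "A = {}" using run_partition[OF r] by auto
  then show ?thesis using run_partition[OF r] r by (simp add: truncated_pivot_def)
qed

lemma orderings_finite_nonempty:
  assumes "finite V"
  shows "finite (orderings V)" "orderings V \<noteq> {}"
proof -
  show "finite (orderings V)"
    unfolding orderings_def using assms by (simp add: finite_PiE)
  obtain f where f: "bij_betw f V {1..card V}"
    using finite_same_card_bij[of V "{1..card V}"] assms by auto
  have "bij_betw (restrict f V) V {1..card V}"
    using f by (simp cong: bij_betw_cong)
  then have "restrict f V \<in> orderings V"
    by (auto simp: orderings_def bij_betw_def)
  then show "orderings V \<noteq> {}" by blast
qed

lemma OPT_attained:
  assumes "finite V"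
  obtains P where "partition_on V P" "OPT V E = cost V E P"
    "\<And>Q. partition_on V Q \<Longrightarrow> OPT V E \<le> cost V E Q"
proof -
  let ?S = "{P. partition_on V P}"
  have fin: "finite ?S" using finitely_many_partition_on[OF assms] .
  have ne: "?S \<noteq> {}" using partition_on_singletons by blast
  have "OPT V E \<in> cost V E ` ?S"
    unfolding OPT_def using fin ne by (intro Min_in) auto
  then obtain P where "partition_on V P" "OPT V E = cost V E P" by auto
  moreover have "OPT V E \<le> cost V E Q" if "partition_on V Q" for Q
    unfolding OPT_def using fin that by (intro Min_le) auto
  ultimately show thesis using that by blast
qed

end

theory Submission
  imports Defs
begin

text \<open>
  A pair decided wrongly by a pivot step is charged to the bad triangle (two positive edges, one
  negative pair) that it forms with the pivot. Each node of a bad triangle is equally likely to be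
  the pivot that charges it, and each pair is charged at most once, so a third of the charging
  probabilities is a fractional packing of bad triangles; as every partition errs on each bad
  triangle, the expected number of charges is at most \<open>3 * OPT\<close>.

  The other errors are the edges from a truncated node \<open>v\<close> to its active neighbors. If \<open>v\<close> has \<open>d\<close>
  active neighbors after \<open>i\<close> steps, none of the first \<open>i\<close> pivots hit them, which has probability at
  most \<open>exp (- i * d / n)\<close>. Hence, except with probability \<open>1 / n ^ 4\<close>, each node truncated at step
  \<open>i\<close> has at most \<open>12 * n * ln n / i\<close> active neighbors, an \<open>O(\<epsilon> / c)\<close> fraction \<open>\<delta>\<close> of its degree.
  All edges at a truncated node end up cut, so these errors make up at most a fraction \<open>2 * \<delta>\<close> of
  the total cost. In the exceptional case the cost is at most \<open>n ^ 2\<close>, and truncation can only occur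
  if \<open>\<epsilon> > 1 / n\<close>, so this case contributes at most \<open>\<epsilon> / 2 \<le> \<epsilon> / 2 * OPT\<close>.
\<close>

section \<open>The run of the algorithm\<close>

locale clustering_instance =
  fixes c \<epsilon> :: real and V :: "'a set" and E :: "'a set set"
  assumes graph: "simple_graph V E"
begin

abbreviation n :: nat where "n \<equiv> card V"

abbreviation cutoff :: "nat \<Rightarrow> real" where "cutoff i \<equiv> threshold c \<epsilon> n i"

definition active :: "('a \<Rightarrow> nat) \<Rightarrow> nat \<Rightarrow> 'a set" where
  "active \<pi> i = fst (run c \<epsilon> V E \<pi> i)"

text \<open>The active nodes between the truncation and the pivot of step \<open>i\<close>. Pivot
  errors are judged on this set, since it is what the pivot sees.\<close>

definition untruncated :: "('a \<Rightarrow> nat) \<Rightarrow> nat \<Rightarrow> 'a set" where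
  "untruncated \<pi> i = {v \<in> active \<pi> (i - 1). real (degree E v) < cutoff i}"

abbreviation pivot_at :: "('a \<Rightarrow> nat) \<Rightarrow> nat \<Rightarrow> 'a" where
  "pivot_at \<pi> i \<equiv> inv_into V \<pi> i"

definition pivot_cluster :: "('a \<Rightarrow> nat) \<Rightarrow> nat \<Rightarrow> 'a set" where
  "pivot_cluster \<pi> i =
     insert (pivot_at \<pi> i) (neighbors E (pivot_at \<pi> i) \<inter> untruncated \<pi> i)"

lemma finite_V: "finite V" and E_pairs: "E \<subseteq> pairs V"
  using graph by (auto simp: simple_graph_def)

lemma finite_pairs: "finite (pairs V)"
  using finite_V by (simp add: pairs_def)

lemma finite_E: "finite E"
  using finite_pairs E_pairs finite_subset by blast

lemma edgeD: "{u, v} \<in> E \<Longrightarrow> u \<in> V \<and> v \<in> V \<and> u \<noteq> v"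
  using E_pairs by (fastforce simp: pairs_def card_2_iff doubleton_eq_iff)

lemma neighbors_subset: "neighbors E v \<subseteq> V"
  using edgeD by (auto simp: neighbors_def)

lemma finite_neighbors: "finite (neighbors E v)"
  using neighbors_subset finite_V finite_subset by blast

lemma degree_le: "degree E v \<le> n"
  unfolding degree_def by (intro card_mono finite_V neighbors_subset)

lemma neighbors_commute: "u \<in> neighbors E v \<longleftrightarrow> v \<in> neighbors E u"
  by (simp add: neighbors_def insert_commute)

lemma active_0 [simp]: "active \<pi> 0 = V"
  by (simp add: active_def)

lemma untruncated_subset: "untruncated \<pi> i \<subseteq> active \<pi> (i - 1)"
  by (auto simp: untruncated_def)

lemma run_Suc_cases:
  "run c \<epsilon> V E \<pi> (Suc i) =
    (let T = snd (run c \<epsilon> V E \<pi> i) \<union> (\<lambda>v. {v}) ` (active \<pi> i - untruncated \<pi> (Suc i))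
     in if pivot_at \<pi> (Suc i) \<in> untruncated \<pi> (Suc i)
        then (untruncated \<pi> (Suc i) - pivot_cluster \<pi> (Suc i), insert (pivot_cluster \<pi> (Suc i)) T)
        else (untruncated \<pi> (Suc i), T))"
proof -
  obtain A P where r: "run c \<epsilon> V E \<pi> i = (A, P)" by fastforce
  have A: "active \<pi> i = A" by (simp add: active_def r)
  have U: "A - {v \<in> A. real (degree E v) \<ge> cutoff (Suc i)} = untruncated \<pi> (Suc i)"
    by (auto simp: untruncated_def A)
  have H: "{v \<in> A. real (degree E v) \<ge> cutoff (Suc i)} = A - untruncated \<pi> (Suc i)"
    by (auto simp: untruncated_def A)
  show ?thesis
    by (simp only: run.simps r truncate_def prod.case Let_def U)
      (simp add: H A pivot_def pivot_cluster_def Let_def)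
qed

lemma active_Suc:
  "active \<pi> (Suc i) =
    (if pivot_at \<pi> (Suc i) \<in> untruncated \<pi> (Suc i)
     then untruncated \<pi> (Suc i) - pivot_cluster \<pi> (Suc i) else untruncated \<pi> (Suc i))"
  by (simp add: active_def[of \<pi> "Suc i"] run_Suc_cases Let_def del: run.simps)

lemma active_Suc_subset: "active \<pi> (Suc i) \<subseteq> untruncated \<pi> (Suc i)"
  by (auto simp: active_Suc)

lemma active_antimono: "i \<le> j \<Longrightarrow> active \<pi> j \<subseteq> active \<pi> i"
proof (induction j rule: dec_induct)
  case (step m)
  then show ?case using active_Suc_subset[of \<pi> m] untruncated_subset[of \<pi> "Suc m"] by auto
qed simp

lemma active_subset: "active \<pi> i \<subseteq> V"
  using active_antimono[of 0 i \<pi>] by simp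

lemma untruncated_subset_V: "untruncated \<pi> i \<subseteq> V"
  using untruncated_subset active_subset by blast

section \<open>Positions, and which of them the run depends on\<close>

lemma orderingD:
  assumes "\<pi> \<in> orderings V"
  shows "inj_on \<pi> V" "\<pi> ` V = {1..n}" "x \<in> V \<Longrightarrow> 1 \<le> \<pi> x \<and> \<pi> x \<le> n"
    "x \<in> V \<Longrightarrow> pivot_at \<pi> (\<pi> x) = x"
  using assms by (auto simp: orderings_def bij_betw_def)

lemma pivot_at_in:
  assumes "\<pi> \<in> orderings V" "1 \<le> j" "j \<le> n"
  shows "pivot_at \<pi> j \<in> V" "\<pi> (pivot_at \<pi> j) = j"
proof -
  have "j \<in> \<pi> ` V" using orderingD(2)[OF assms(1)] assms(2,3) by simp
  then show "pivot_at \<pi> j \<in> V" "\<pi> (pivot_at \<pi> j) = j"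
    by (auto simp: inv_into_into f_inv_into_f)
qed

lemma active_position:
  assumes "\<pi> \<in> orderings V" "x \<in> active \<pi> i"
  shows "i < \<pi> x"
proof -
  have "x \<in> V" using assms(2) active_subset by blast
  have "active \<pi> i \<subseteq> V - inv_into V \<pi> ` {1..i}"
    using run_partition[of c \<epsilon> V E \<pi> i] by (metis active_def prod.collapse)
  then have "x \<notin> inv_into V \<pi> ` {1..i}" using assms(2) by blast
  moreover have "x = pivot_at \<pi> (\<pi> x)" "1 \<le> \<pi> x" using orderingD[OF assms(1)] \<open>x \<in> V\<close> by auto
  ultimately show ?thesis by (metis atLeastAtMost_iff image_eqI not_le)
qed

text \<open>The first \<open>i\<close> steps look up only the nodes at positions up to
  \<open>i\<close>. Together with \<open>untruncated_cong\<close> this makes the exchange arguments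
  below possible.\<close>

lemma run_cong:
  assumes "\<pi> \<in> orderings V" "\<pi>' \<in> orderings V" "i \<le> n"
    "\<And>x. x \<in> V \<Longrightarrow> \<pi> x \<le> i \<Longrightarrow> \<pi>' x = \<pi> x"
  shows "run c \<epsilon> V E \<pi>' i = run c \<epsilon> V E \<pi> i"
  using assms(3,4)
proof (induction i)
  case (Suc i)
  let ?x = "pivot_at \<pi> (Suc i)"
  have x: "?x \<in> V" "\<pi> ?x = Suc i" using pivot_at_in[OF assms(1)] Suc.prems(1) by auto
  then have "\<pi>' ?x = Suc i" using Suc.prems(2) by simp
  then have "pivot_at \<pi>' (Suc i) = ?x" using orderingD(4)[OF assms(2) x(1)] by simp
  then show ?case using Suc by simp
qed simp

text \<open>Truncation precedes the lookup of the pivot, so only positions strictly below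
  \<open>i\<close> matter. The node at position \<open>i\<close> itself may therefore be exchanged
  freely.\<close>

lemma untruncated_cong:
  assumes "\<pi> \<in> orderings V" "\<pi>' \<in> orderings V" "1 \<le> i" "i \<le> n"
    "\<And>x. x \<in> V \<Longrightarrow> \<pi> x < i \<Longrightarrow> \<pi>' x = \<pi> x"
  shows "untruncated \<pi>' i = untruncated \<pi> i"
  using run_cong[OF assms(1,2), of "i - 1"] assms(3-5)
  by (fastforce simp: untruncated_def active_def)

lemma mem_run_clusters_iff:
  "C \<in> snd (run c \<epsilon> V E \<pi> i) \<longleftrightarrow>
    (\<exists>j\<in>{1..i}. (\<exists>v \<in> active \<pi> (j - 1) - untruncated \<pi> j. C = {v}) \<or>
       pivot_at \<pi> j \<in> untruncated \<pi> j \<and> C = pivot_cluster \<pi> j)"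
proof (induction i)
  case (Suc i)
  have "{1..Suc i} = insert (Suc i) {1..i}" by auto
  then show ?case by (auto simp: run_Suc_cases Let_def Suc simp del: run.simps)
qed simp

lemma mem_clusters_iff:
  "C \<in> truncated_pivot c \<epsilon> V E \<pi> \<longleftrightarrow>
    (\<exists>j\<in>{1..n}. (\<exists>v \<in> active \<pi> (j - 1) - untruncated \<pi> j. C = {v}) \<or>
       pivot_at \<pi> j \<in> untruncated \<pi> j \<and> C = pivot_cluster \<pi> j)"
  by (simp only: truncated_pivot_def mem_run_clusters_iff)

section \<open>Bad triangles\<close>

definition bad_triangles :: "'a set set" where
  "bad_triangles = {t. \<exists>x y z. t = {x, y, z} \<and> y \<noteq> z \<and> {x, y} \<in> E \<and> {x, z} \<in> E \<and> {y, z} \<notin> E}"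

lemma bad_triangleD:
  assumes "t \<in> bad_triangles"
  shows "t \<subseteq> V" "card t = 3" "finite t"
    "w \<in> t \<Longrightarrow> t - {w} \<in> pairs V"
    "w \<in> t \<Longrightarrow> \<exists>x\<in>t - {w}. {w, x} \<in> E"
proof -
  obtain x y z where t: "t = {x, y, z}" "y \<noteq> z" "{x, y} \<in> E" "{x, z} \<in> E"
    using assms by (auto simp: bad_triangles_def)
  note e = edgeD[OF t(3)] edgeD[OF t(4)]
  show V: "t \<subseteq> V" and c: "card t = 3" and f: "finite t" using t e by auto
  show "t - {w} \<in> pairs V" if "w \<in> t" using V c f that by (auto simp: pairs_def)
  show "\<exists>x\<in>t - {w}. {w, x} \<in> E" if "w \<in> t" using that t e by (auto simp: insert_commute)
qed

lemma finite_bad_triangles: "finite bad_triangles"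
  using finite_subset[of bad_triangles "Pow V"] bad_triangleD(1) finite_V by blast

text \<open>As \<open>w\<close> lies in \<open>t\<close>, the last condition also says that
  \<open>w\<close> is active at its own turn and so really creates a cluster. The blamed pair is the
  one opposite to \<open>w\<close>: a joined non-edge if \<open>w\<close> is the common neighbor of
  the other two nodes, a cut edge otherwise.\<close>

definition charges :: "('a \<Rightarrow> nat) \<Rightarrow> ('a \<times> 'a set) set" where
  "charges \<pi> = {(w, t). t \<in> bad_triangles \<and> w \<in> t \<and> t \<subseteq> untruncated \<pi> (\<pi> w)}"

definition charged_pair :: "'a \<times> 'a set \<Rightarrow> 'a set" where
  "charged_pair = (\<lambda>(w, t). t - {w})"

lemma finite_charges: "finite (charges \<pi>)"
proof (rule finite_subset)
  show "charges \<pi> \<subseteq> V \<times> bad_triangles" using bad_triangleD(1) by (auto simp: charges_def)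
qed (simp add: finite_V finite_bad_triangles)

text \<open>Every node of a bad triangle is adjacent to another one of its nodes, so the cluster of
  the pivot \<open>w\<close> takes at least one endpoint of the opposite pair.\<close>

lemma charge_removes_endpoint:
  assumes "\<pi> \<in> orderings V" "(w, t) \<in> charges \<pi>" "\<pi> w \<le> j"
  shows "\<not> t - {w} \<subseteq> active \<pi> j"
proof -
  have t: "t \<in> bad_triangles" "w \<in> t" "t \<subseteq> untruncated \<pi> (\<pi> w)"
    using assms(2) by (auto simp: charges_def)
  have w: "w \<in> V" using t bad_triangleD(1) by blast
  obtain i where i: "\<pi> w = Suc i" using orderingD(3)[OF assms(1) w] by (cases "\<pi> w") auto
  have p: "pivot_at \<pi> (Suc i) = w" using orderingD(4)[OF assms(1) w] i by simp
  obtain x where x: "x \<in> t - {w}" "{w, x} \<in> E" using bad_triangleD(5)[OF t(1,2)] by blast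
  have "x \<in> pivot_cluster \<pi> (Suc i)"
    using x t(3) by (auto simp: pivot_cluster_def p neighbors_def i)
  then have "x \<notin> active \<pi> (Suc i)" using t p i by (auto simp: active_Suc)
  then show ?thesis using active_antimono[of "Suc i" j \<pi>] assms(3) i x by auto
qed

text \<open>Once a pair is charged, one of its endpoints is inactive, so no later pivot can charge
  it again. Charges of the same pair thus happen at the same position, hence with the same pivot and
  triangle.\<close>

lemma inj_on_charged_pair:
  assumes "\<pi> \<in> orderings V"
  shows "inj_on charged_pair (charges \<pi>)"
proof -
  have not_less: "\<not> \<pi> w < \<pi> w'"
    if "(w, t) \<in> charges \<pi>" "(w', t') \<in> charges \<pi>" "t - {w} = t' - {w'}" for w t w' t'
  proof
    assume "\<pi> w < \<pi> w'"
    then have "\<not> t - {w} \<subseteq> active \<pi> (\<pi> w' - 1)"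
      using charge_removes_endpoint[OF assms that(1)] by simp
    moreover have "t' \<subseteq> active \<pi> (\<pi> w' - 1)"
      using that(2) untruncated_subset by (fastforce simp: charges_def)
    ultimately show False using that(3) by blast
  qed
  show ?thesis
  proof (rule inj_onI, clarify)
    fix w t w' t'
    assume a: "(w, t) \<in> charges \<pi>" "(w', t') \<in> charges \<pi>"
      and "charged_pair (w, t) = charged_pair (w', t')"
    then have eq: "t - {w} = t' - {w'}" by (simp add: charged_pair_def)
    have "\<pi> w = \<pi> w'" using not_less[OF a eq] not_less[OF a(2,1) eq[symmetric]] by simp
    moreover have "w \<in> t" "w' \<in> t'" "w \<in> V" "w' \<in> V"
      using a bad_triangleD(1) by (auto simp: charges_def)
    ultimately have "w = w'" using orderingD(1)[OF assms] by (simp add: inj_on_def)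
    then show "w = w' \<and> t = t'" using eq \<open>w \<in> t\<close> \<open>w' \<in> t'\<close> by blast
  qed
qed

section \<open>Exchanging two nodes of an ordering\<close>

lemma swap_ordering:
  assumes "\<pi> \<in> orderings V" "u \<in> V" "w \<in> V"
  shows "\<pi> \<circ> Transposition.transpose u w \<in> orderings V"
proof -
  have b: "bij_betw (Transposition.transpose u w) V V"
    using assms(2,3) by (intro bij_betwI[where g = "Transposition.transpose u w"]) (auto simp: Transposition.transpose_def)
  have "bij_betw \<pi> V {1..n}" using assms(1) by (simp add: orderings_def)
  then have bb: "bij_betw (\<pi> \<circ> Transposition.transpose u w) V {1..n}" using b bij_betw_trans by blast
  moreover have "\<pi> \<circ> Transposition.transpose u w \<in> extensional V"
    using assms by (auto simp: orderings_def extensional_def PiE_def Transposition.transpose_def)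
  moreover have "\<pi> \<circ> Transposition.transpose u w \<in> V \<rightarrow> {1..n}" using bij_betw_imp_funcset[OF bb] .
  ultimately show ?thesis by (simp add: orderings_def PiE_def)
qed

definition charging_orderings :: "'a \<Rightarrow> 'a set \<Rightarrow> ('a \<Rightarrow> nat) set" where
  "charging_orderings w t = {\<pi> \<in> orderings V. t \<subseteq> untruncated \<pi> (\<pi> w)}"

text \<open>Given that a pivot is chosen in \<open>t\<close> while \<open>t\<close> is still active, each node of \<open>t\<close> is
  equally likely to be that pivot: exchanging the positions of the pivot and another node of
  \<open>t\<close> leaves the earlier history of the run unchanged.\<close>

lemma card_charging_orderings_le:
  assumes "u \<in> t" "w \<in> t" "t \<subseteq> V"
  shows "card (charging_orderings w t) \<le> card (charging_orderings u t)"
proof (rule card_inj_on_le[where f = "\<lambda>\<pi>. \<pi> \<circ> Transposition.transpose u w"])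
  show "inj_on (\<lambda>\<pi>. \<pi> \<circ> Transposition.transpose u w) (charging_orderings w t)"
  proof (rule inj_onI)
    fix f g :: "'a \<Rightarrow> nat" assume "f \<circ> Transposition.transpose u w = g \<circ> Transposition.transpose u w"
    then have "(f \<circ> Transposition.transpose u w) \<circ> Transposition.transpose u w = (g \<circ> Transposition.transpose u w) \<circ> Transposition.transpose u w" by simp
    then show "f = g" by (simp add: comp_assoc)
  qed
  show "finite (charging_orderings u t)"
    using orderings_finite_nonempty(1)[OF finite_V] by (simp add: charging_orderings_def)
  show "(\<lambda>\<pi>. \<pi> \<circ> Transposition.transpose u w) ` charging_orderings w t \<subseteq> charging_orderings u t"
  proof clarify
    fix \<pi> assume "\<pi> \<in> charging_orderings w t"
    then have \<pi>: "\<pi> \<in> orderings V" "t \<subseteq> untruncated \<pi> (\<pi> w)"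
      by (auto simp: charging_orderings_def)
    have uw: "u \<in> V" "w \<in> V" using assms by auto
    let ?\<sigma> = "\<pi> \<circ> Transposition.transpose u w"
    have \<sigma>: "?\<sigma> \<in> orderings V" using swap_ordering[OF \<pi>(1) uw] .
    \<comment> \<open>Both exchanged nodes sit at positions at least \<open>\<pi> w\<close>, so the
      exchange leaves every earlier position alone.\<close>
    have "u \<in> active \<pi> (\<pi> w - 1)" using \<pi>(2) assms(1) untruncated_subset by blast
    then have le: "\<pi> w \<le> \<pi> u" using active_position[OF \<pi>(1)] by fastforce
    have "untruncated ?\<sigma> (\<pi> w) = untruncated \<pi> (\<pi> w)"
    proof (rule untruncated_cong[OF \<pi>(1) \<sigma>])
      show "?\<sigma> x = \<pi> x" if "\<pi> x < \<pi> w" for x using that le by (auto simp: Transposition.transpose_def)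
    qed (use orderingD(3)[OF \<pi>(1) uw(2)] in auto)
    then show "?\<sigma> \<in> charging_orderings u t" using \<sigma> \<pi>(2) by (simp add: charging_orderings_def)
  qed
qed

lemma card_charging_orderings_eq:
  assumes "u \<in> t" "w \<in> t" "t \<subseteq> V"
  shows "card (charging_orderings w t) = card (charging_orderings u t)"
  using card_charging_orderings_le assms by (meson le_antisym)

text \<open>If both positive edges lie within clusters, these clusters share the common endpoint and
  hence coincide, which joins the negative pair.\<close>

lemma partition_violates_bad_triangle:
  assumes "t \<in> bad_triangles" "partition_on V Q"
  shows "\<exists>w\<in>t. t - {w} \<in> {e \<in> E. \<not> (\<exists>C\<in>Q. e \<subseteq> C)} \<union> {e \<in> pairs V - E. \<exists>C\<in>Q. e \<subseteq> C}"
proof -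
  obtain x y z where t: "t = {x, y, z}" "y \<noteq> z" "{x, y} \<in> E" "{x, z} \<in> E" "{y, z} \<notin> E"
    using assms by (auto simp: bad_triangles_def)
  note e = edgeD[OF t(3)] edgeD[OF t(4)]
  have d: "t - {x} = {y, z}" "t - {y} = {x, z}" "t - {z} = {x, y}" using t e by auto
  have p: "{y, z} \<in> pairs V - E" using t e by (auto simp: pairs_def)
  show ?thesis
  proof (cases "(\<exists>C\<in>Q. {x, y} \<subseteq> C) \<and> (\<exists>C\<in>Q. {x, z} \<subseteq> C)")
    case True
    then obtain C D where "C \<in> Q" "{x, y} \<subseteq> C" "D \<in> Q" "{x, z} \<subseteq> D" by blast
    moreover from this have "C = D"
      using assms(2) by (auto simp: partition_on_def disjoint_def)
    ultimately have "\<exists>C\<in>Q. {y, z} \<subseteq> C" by blast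
    then show ?thesis using p d t(1) by (intro bexI[of _ x]) auto
  next
    case False
    then consider "\<not> (\<exists>C\<in>Q. {x, y} \<subseteq> C)" | "\<not> (\<exists>C\<in>Q. {x, z} \<subseteq> C)" by blast
    then show ?thesis
    proof cases
      case 1
      then show ?thesis using d(3) t by (intro bexI[of _ z]) auto
    next
      case 2
      then show ?thesis using d(2) t by (intro bexI[of _ y]) auto
    qed
  qed
qed

text \<open>The packing argument as a double count. In every bad triangle, fix one node opposite to
  an error of an optimal partition. By symmetry that node makes a third of the charges of the
  triangle, and for each ordering these selected charges inject into the errors of the
  optimum.\<close>

lemma sum_card_charges_le:
  "(\<Sum>\<pi>\<in>orderings V. card (charges \<pi>)) \<le> 3 * (card (orderings V) * OPT V E)"
proof -
  obtain Q where Q: "partition_on V Q" "OPT V E = cost V E Q" using OPT_attained[OF finite_V] by blast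
  define X where "X = {e \<in> E. \<not> (\<exists>C\<in>Q. e \<subseteq> C)} \<union> {e \<in> pairs V - E. \<exists>C\<in>Q. e \<subseteq> C}"
  have finX: "finite X" using finite_E finite_pairs by (simp add: X_def)
  have "card X = cost V E Q" unfolding X_def cost_def
    using finite_E finite_pairs by (intro card_Un_disjoint) auto
  then have cX: "card X = OPT V E" using Q by simp
  have "\<forall>t\<in>bad_triangles. \<exists>w. w \<in> t \<and> t - {w} \<in> X"
  proof
    fix t assume "t \<in> bad_triangles"
    from partition_violates_bad_triangle[OF this Q(1)]
    show "\<exists>w. w \<in> t \<and> t - {w} \<in> X" unfolding X_def Bex_def .
  qed
  \<comment> \<open>\<open>f t\<close> is the selected node: the pair of \<open>t\<close> opposite
    to it is an error of \<open>Q\<close>.\<close>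
  from bchoice[OF this] obtain f where
    f: "\<And>t. t \<in> bad_triangles \<Longrightarrow> f t \<in> t \<and> t - {f t} \<in> X" by blast
  have finO: "finite (orderings V)" using orderings_finite_nonempty(1)[OF finite_V] .
  define Z where "Z = Sigma bad_triangles (\<lambda>t. t)"
  have finZ: "finite Z" unfolding Z_def
    using finite_bad_triangles bad_triangleD(3) by (intro finite_SigmaI) auto
  have charging: "{\<pi> \<in> orderings V. (w, t) \<in> charges \<pi>} = charging_orderings w t"
    if "t \<in> bad_triangles" "w \<in> t" for w t
    using that by (auto simp: charges_def charging_orderings_def)
  have "(\<Sum>\<pi>\<in>orderings V. card (charges \<pi>)) =
      (\<Sum>\<pi>\<in>orderings V. card {p \<in> Z. (snd p, fst p) \<in> charges \<pi>})"
  proof (rule sum.cong[OF refl])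
    fix \<pi>
    have "{p \<in> Z. (snd p, fst p) \<in> charges \<pi>} = (charges \<pi>)\<inverse>"
      by (auto simp: Z_def charges_def)
    then show "card (charges \<pi>) = card {p \<in> Z. (snd p, fst p) \<in> charges \<pi>}"
      by (simp only: card_inverse)
  qed
  also have "\<dots> = (\<Sum>p\<in>Z. card (charging_orderings (snd p) (fst p)))"
    by (rule sum_multicount_gen[OF finO finZ]) (auto simp: Z_def charging)
  also have "\<dots> = (\<Sum>t\<in>bad_triangles. \<Sum>w\<in>t. card (charging_orderings w t))"
    unfolding Z_def using finite_bad_triangles bad_triangleD(3)
    by (subst sum.Sigma) (auto simp: split_def)
  \<comment> \<open>All three nodes of \<open>t\<close> are the charging pivot in equally many
    orderings, so it suffices to count those of \<open>f t\<close>.\<close>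
  also have "\<dots> = (\<Sum>t\<in>bad_triangles. 3 * card (charging_orderings (f t) t))"
  proof (rule sum.cong[OF refl])
    fix t assume t: "t \<in> bad_triangles"
    have "(\<Sum>w\<in>t. card (charging_orderings w t)) = (\<Sum>w\<in>t. card (charging_orderings (f t) t))"
      using f[OF t] bad_triangleD(1)[OF t] by (intro sum.cong[OF refl] card_charging_orderings_eq) auto
    then show "(\<Sum>w\<in>t. card (charging_orderings w t)) = 3 * card (charging_orderings (f t) t)"
      using bad_triangleD(2)[OF t] by simp
  qed
  also have "\<dots> = 3 * (\<Sum>t\<in>bad_triangles. card (charging_orderings (f t) t))"
    by (simp add: sum_distrib_left)
  also have "(\<Sum>t\<in>bad_triangles. card (charging_orderings (f t) t)) =
      (\<Sum>\<pi>\<in>orderings V. card {t \<in> bad_triangles. (f t, t) \<in> charges \<pi>})"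
    by (rule sum_multicount_gen[OF finO finite_bad_triangles, symmetric]) (use f charging in auto)
  \<comment> \<open>For a fixed ordering no pair is charged twice, so the selected triangles are
    determined by their opposite pairs, which lie in \<open>X\<close>.\<close>
  also have "\<dots> \<le> (\<Sum>\<pi>\<in>orderings V. card X)"
  proof (rule sum_mono)
    fix \<pi> assume \<pi>: "\<pi> \<in> orderings V"
    show "card {t \<in> bad_triangles. (f t, t) \<in> charges \<pi>} \<le> card X"
    proof (rule card_inj_on_le[where f = "\<lambda>t. t - {f t}"])
      show "inj_on (\<lambda>t. t - {f t}) {t \<in> bad_triangles. (f t, t) \<in> charges \<pi>}"
        using inj_on_charged_pair[OF \<pi>] by (auto simp: inj_on_def charged_pair_def)
    qed (use f finX in auto)
  qed
  finally show ?thesis by (simp add: cX)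
qed

section \<open>Edges cut by truncation\<close>

definition truncated_at :: "('a \<Rightarrow> nat) \<Rightarrow> nat \<Rightarrow> 'a set" where
  "truncated_at \<pi> i = active \<pi> (i - 1) - untruncated \<pi> i"

lemma truncated_at_disjoint:
  assumes "1 \<le> i" "i < j"
  shows "truncated_at \<pi> i \<inter> truncated_at \<pi> j = {}"
proof -
  have "active \<pi> (j - 1) \<subseteq> active \<pi> i" using assms by (intro active_antimono) auto
  moreover have "active \<pi> i \<subseteq> untruncated \<pi> i"
    using active_Suc_subset[of \<pi> "i - 1"] assms(1) by simp
  ultimately show ?thesis by (auto simp: truncated_at_def)
qed

definition cut_edges :: "('a \<Rightarrow> nat) \<Rightarrow> 'a set set" where
  "cut_edges \<pi> = {e \<in> E. \<not> (\<exists>C\<in>truncated_pivot c \<epsilon> V E \<pi>. e \<subseteq> C)}"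

definition joined_nonedges :: "('a \<Rightarrow> nat) \<Rightarrow> 'a set set" where
  "joined_nonedges \<pi> = {e \<in> pairs V - E. \<exists>C\<in>truncated_pivot c \<epsilon> V E \<pi>. e \<subseteq> C}"

text \<open>Only neighbors active at the start of the step are included: an edge whose other
  endpoint is already inactive was decided at an earlier step.\<close>

definition truncation_cuts :: "('a \<Rightarrow> nat) \<Rightarrow> 'a set set" where
  "truncation_cuts \<pi> = (\<Union>i\<in>{1..n}. \<Union>v\<in>truncated_at \<pi> i.
     (\<lambda>x. {v, x}) ` (neighbors E v \<inter> active \<pi> (i - 1)))"

lemma cost_eq: "cost V E (truncated_pivot c \<epsilon> V E \<pi>) = card (cut_edges \<pi>) + card (joined_nonedges \<pi>)"
  by (simp add: cost_def cut_edges_def joined_nonedges_def)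

lemma finite_cut_edges: "finite (cut_edges \<pi>)"
  using finite_E by (simp add: cut_edges_def)

lemma finite_truncated_at: "finite (truncated_at \<pi> i)"
  using active_subset[of \<pi> "i - 1"] finite_V finite_subset by (auto simp: truncated_at_def)

section \<open>Attributing each error to a charge or a truncation\<close>

lemma charged_pairI:
  assumes "\<pi> \<in> orderings V" "j \<in> {1..n}" "pivot_at \<pi> j \<in> untruncated \<pi> j"
    "{x, y} \<subseteq> untruncated \<pi> j" "{pivot_at \<pi> j, x, y} \<in> bad_triangles"
    "pivot_at \<pi> j \<noteq> x" "pivot_at \<pi> j \<noteq> y"
  shows "{x, y} \<in> charged_pair ` charges \<pi>"
proof (rule image_eqI)
  show "(pivot_at \<pi> j, {pivot_at \<pi> j, x, y}) \<in> charges \<pi>"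
    using assms pivot_at_in(2)[OF assms(1), of j] by (auto simp: charges_def)
  show "{x, y} = charged_pair (pivot_at \<pi> j, {pivot_at \<pi> j, x, y})"
    using assms(6,7) by (auto simp: charged_pair_def)
qed

text \<open>Singletons contain no pair, so the cluster has a pivot. The pivot is adjacent to all
  other members, so it is not an endpoint of the non-edge and completes it to a bad
  triangle.\<close>

lemma joined_nonedges_charged:
  assumes "\<pi> \<in> orderings V"
  shows "joined_nonedges \<pi> \<subseteq> charged_pair ` charges \<pi>"
proof
  fix e assume "e \<in> joined_nonedges \<pi>"
  then obtain C where e: "e \<in> pairs V" "e \<notin> E" and C: "C \<in> truncated_pivot c \<epsilon> V E \<pi>" "e \<subseteq> C"
    by (auto simp: joined_nonedges_def)
  obtain x y where xy: "e = {x, y}" "x \<noteq> y" using e by (auto simp: pairs_def card_2_iff)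
  then have "C \<noteq> {v}" for v using C by auto
  then obtain j where j: "j \<in> {1..n}" "pivot_at \<pi> j \<in> untruncated \<pi> j" "C = pivot_cluster \<pi> j"
    using C(1) unfolding mem_clusters_iff by blast
  let ?w = "pivot_at \<pi> j"
  have adj: "z = ?w \<or> {?w, z} \<in> E \<and> z \<in> untruncated \<pi> j" if "z \<in> C" for z
    using that j(3) by (auto simp: pivot_cluster_def neighbors_def)
  have "?w \<noteq> x" using adj[of y] e xy C by auto
  moreover have "?w \<noteq> y" using adj[of x] e xy C by (auto simp: insert_commute)
  moreover have "{?w, x, y} \<in> bad_triangles"
  proof -
    have "{?w, x} \<in> E" "{?w, y} \<in> E" using adj[of x] adj[of y] calculation xy(1) C(2) by auto
    then show ?thesis using e(2) xy unfolding bad_triangles_def by blast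
  qed
  moreover have "{x, y} \<subseteq> untruncated \<pi> j" using adj[of x] adj[of y] xy C j by auto
  ultimately show "e \<in> charged_pair ` charges \<pi>"
    using charged_pairI[OF assms j(1,2)] xy(1) by blast
qed

lemma active_n: "\<pi> \<in> orderings V \<Longrightarrow> active \<pi> n = {}"
  using active_position active_subset orderingD(3) by (metis ex_in_conv leD subsetD)

text \<open>The edge is classified by the first step that makes an endpoint inactive. Before that
  step both endpoints are active, so either one of them is truncated or the pivot takes exactly one
  of them.\<close>

lemma cut_edges_charged_or_truncated:
  assumes "\<pi> \<in> orderings V"
  shows "cut_edges \<pi> \<subseteq> charged_pair ` charges \<pi> \<union> truncation_cuts \<pi>"
proof
  fix e assume e: "e \<in> cut_edges \<pi>"
  then have eE: "e \<in> E" and cut: "\<And>C. C \<in> truncated_pivot c \<epsilon> V E \<pi> \<Longrightarrow> \<not> e \<subseteq> C"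
    by (auto simp: cut_edges_def)
  have eV: "e \<subseteq> V" "e \<noteq> {}" using eE E_pairs by (auto simp: pairs_def)
  have ex: "\<not> e \<subseteq> active \<pi> n" using active_n[OF assms] eV by simp
  define i where "i = (LEAST i. \<not> e \<subseteq> active \<pi> i)"
  have i: "\<not> e \<subseteq> active \<pi> i" "i \<le> n" unfolding i_def
    using LeastI[of "\<lambda>i. \<not> e \<subseteq> active \<pi> i" n, OF ex]
      Least_le[of "\<lambda>i. \<not> e \<subseteq> active \<pi> i" n, OF ex] by blast+
  then obtain k where k: "i = Suc k" using eV by (cases i) auto
  have ek: "e \<subseteq> active \<pi> k" using not_less_Least[of k "\<lambda>i. \<not> e \<subseteq> active \<pi> i"] k i_def by auto
  have kn: "Suc k \<in> {1..n}" using i k by simp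
  show "e \<in> charged_pair ` charges \<pi> \<union> truncation_cuts \<pi>"
  proof (cases "e \<subseteq> untruncated \<pi> (Suc k)")
    case False
    then obtain v where v: "v \<in> e" "v \<in> truncated_at \<pi> (Suc k)"
      using ek by (auto simp: truncated_at_def)
    have "card e = 2" using eE E_pairs by (auto simp: pairs_def)
    then obtain x where x: "e = {v, x}" using v(1) by (auto simp: card_2_iff)
    then have "x \<in> neighbors E v \<inter> active \<pi> (Suc k - 1)" using eE ek by (auto simp: neighbors_def)
    then have "e \<in> truncation_cuts \<pi>" unfolding truncation_cuts_def using kn v(2) x by blast
    then show ?thesis by blast
  next
    case True
    let ?w = "pivot_at \<pi> (Suc k)"
    have w: "?w \<in> untruncated \<pi> (Suc k)" using i(1) k True by (auto simp: active_Suc split: if_splits)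
    have "\<not> e \<subseteq> pivot_cluster \<pi> (Suc k)"
      by (rule cut) (use w kn in \<open>auto simp: mem_clusters_iff\<close>)
    moreover have "\<exists>x\<in>e. x \<in> pivot_cluster \<pi> (Suc k)"
      using i(1) k True w by (auto simp: active_Suc)
    ultimately obtain x y where xy: "x \<in> e" "y \<in> e" "x \<in> pivot_cluster \<pi> (Suc k)"
      "y \<notin> pivot_cluster \<pi> (Suc k)" by blast
    have "card e = 2" using eE E_pairs by (auto simp: pairs_def)
    moreover have "x \<noteq> y" using xy by auto
    ultimately have e2: "e = {x, y}" using xy(1,2) by (auto simp: card_2_iff)
    have y: "?w \<noteq> y" "{?w, y} \<notin> E"
      using xy(2,4) True by (auto simp: pivot_cluster_def neighbors_def)
    \<comment> \<open>If the pivot were \<open>x\<close>, the edge \<open>e\<close> would put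
      \<open>y\<close> into its cluster.\<close>
    have x: "?w \<noteq> x" using y(2) eE e2 by auto
    then have "{?w, x} \<in> E" using xy(3) by (auto simp: pivot_cluster_def neighbors_def)
    \<comment> \<open>The captured endpoint \<open>x\<close> is the common neighbor; the negative
      pair consists of the pivot and \<open>y\<close>.\<close>
    then have "{?w, x, y} \<in> bad_triangles"
      unfolding bad_triangles_def using y e2 eE
      by (intro CollectI exI[of _ x] exI[of _ ?w] exI[of _ y]) (auto simp: insert_commute)
    then show ?thesis using charged_pairI[OF assms kn w _ _ x y(1)] True e2 by blast
  qed
qed

text \<open>A truncated node ends as a singleton, so all its edges are cut, and each cut edge is
  counted at most once per endpoint.\<close>

lemma sum_degree_truncated_le:
  assumes "\<pi> \<in> orderings V"
  shows "(\<Sum>i\<in>{1..n}. \<Sum>v\<in>truncated_at \<pi> i. degree E v) \<le> 2 * card (cut_edges \<pi>)"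
proof -
  let ?T = "\<Union>i\<in>{1..n}. truncated_at \<pi> i"
  have finT: "finite ?T" using finite_truncated_at by blast
  have part: "partition_on V (truncated_pivot c \<epsilon> V E \<pi>)" using partition_on_truncated_pivot[OF assms] .
  have deg: "degree E v \<le> card {e \<in> cut_edges \<pi>. v \<in> e}" if "v \<in> ?T" for v
    unfolding degree_def
  proof (rule card_inj_on_le[where f = "\<lambda>x. {v, x}"])
    show "inj_on (\<lambda>x. {v, x}) (neighbors E v)" by (auto simp: inj_on_def doubleton_eq_iff)
    have sing: "{v} \<in> truncated_pivot c \<epsilon> V E \<pi>"
      unfolding mem_clusters_iff using that by (auto simp: truncated_at_def)
    show "(\<lambda>x. {v, x}) ` neighbors E v \<subseteq> {e \<in> cut_edges \<pi>. v \<in> e}"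
    proof clarify
      fix x assume "x \<in> neighbors E v"
      then have x: "{v, x} \<in> E" "x \<noteq> v" using edgeD by (auto simp: neighbors_def)
      have "\<not> {v, x} \<subseteq> C" if C: "C \<in> truncated_pivot c \<epsilon> V E \<pi>" for C
      proof
        assume vC: "{v, x} \<subseteq> C"
        then have "C \<noteq> {v}" using x(2) by auto
        then have "C \<inter> {v} = {}" using part sing C by (simp add: partition_on_def disjoint_def)
        then show False using vC by auto
      qed
      then show "{v, x} \<in> cut_edges \<pi> \<and> v \<in> {v, x}" using x(1) by (auto simp: cut_edges_def)
    qed
  qed (simp add: finite_cut_edges)
  have "(\<Sum>i\<in>{1..n}. \<Sum>v\<in>truncated_at \<pi> i. degree E v) = (\<Sum>v\<in>?T. degree E v)"
  proof (rule sum.UNION_disjoint[symmetric])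
    show "\<forall>i\<in>{1..n}. \<forall>j\<in>{1..n}. i \<noteq> j \<longrightarrow> truncated_at \<pi> i \<inter> truncated_at \<pi> j = {}"
      using truncated_at_disjoint by (metis Int_commute atLeastAtMost_iff linorder_neqE_nat)
  qed (use finite_truncated_at in auto)
  also have "\<dots> \<le> (\<Sum>v\<in>?T. card {e \<in> cut_edges \<pi>. v \<in> e})" by (rule sum_mono) (rule deg)
  also have "\<dots> = (\<Sum>e\<in>cut_edges \<pi>. card {v \<in> ?T. v \<in> e})"
    by (rule sum_multicount_gen[OF finT finite_cut_edges]) simp
  also have "\<dots> \<le> (\<Sum>e\<in>cut_edges \<pi>. 2)"
  proof (rule sum_mono)
    fix e assume "e \<in> cut_edges \<pi>"
    then have c2: "card e = 2" using E_pairs by (auto simp: cut_edges_def pairs_def)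
    then have "finite e" by (metis card.infinite zero_neq_numeral)
    then have "card {v \<in> ?T. v \<in> e} \<le> card e" by (intro card_mono) auto
    then show "card {v \<in> ?T. v \<in> e} \<le> 2" using c2 by simp
  qed
  finally show ?thesis by simp
qed

text \<open>The likely event of the analysis: each truncation newly cuts at most a fraction
  \<open>\<delta>\<close> of the edges at the truncated node.\<close>

definition good :: "real \<Rightarrow> ('a \<Rightarrow> nat) \<Rightarrow> bool" where
  "good \<delta> \<pi> \<longleftrightarrow> (\<forall>i\<in>{1..n}. \<forall>v\<in>truncated_at \<pi> i.
     real (card (neighbors E v \<inter> active \<pi> (i - 1))) \<le> \<delta> * real (degree E v))"

lemma card_truncation_cuts_le:
  assumes "\<pi> \<in> orderings V" "good \<delta> \<pi>" "0 \<le> \<delta>"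
  shows "real (card (truncation_cuts \<pi>)) \<le> 2 * \<delta> * real (card (cut_edges \<pi>))"
proof -
  have "card (truncation_cuts \<pi>) \<le>
      (\<Sum>i\<in>{1..n}. card (\<Union>v\<in>truncated_at \<pi> i. (\<lambda>x. {v, x}) ` (neighbors E v \<inter> active \<pi> (i - 1))))"
    unfolding truncation_cuts_def by (rule card_UN_le) simp
  also have "\<dots> \<le> (\<Sum>i\<in>{1..n}. \<Sum>v\<in>truncated_at \<pi> i. card (neighbors E v \<inter> active \<pi> (i - 1)))"
  proof (rule sum_mono)
    fix i
    have "card (\<Union>v\<in>truncated_at \<pi> i. (\<lambda>x. {v, x}) ` (neighbors E v \<inter> active \<pi> (i - 1)))
      \<le> (\<Sum>v\<in>truncated_at \<pi> i. card ((\<lambda>x. {v, x}) ` (neighbors E v \<inter> active \<pi> (i - 1))))"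
      by (rule card_UN_le[OF finite_truncated_at])
    also have "\<dots> \<le> (\<Sum>v\<in>truncated_at \<pi> i. card (neighbors E v \<inter> active \<pi> (i - 1)))"
      by (intro sum_mono card_image_le) (simp add: finite_neighbors)
    finally show "card (\<Union>v\<in>truncated_at \<pi> i. (\<lambda>x. {v, x}) ` (neighbors E v \<inter> active \<pi> (i - 1)))
      \<le> (\<Sum>v\<in>truncated_at \<pi> i. card (neighbors E v \<inter> active \<pi> (i - 1)))" .
  qed
  finally have "real (card (truncation_cuts \<pi>)) \<le>
      real (\<Sum>i\<in>{1..n}. \<Sum>v\<in>truncated_at \<pi> i. card (neighbors E v \<inter> active \<pi> (i - 1)))"
    by (simp only: of_nat_le_iff)
  also have "\<dots> = (\<Sum>i\<in>{1..n}. \<Sum>v\<in>truncated_at \<pi> i. real (card (neighbors E v \<inter> active \<pi> (i - 1))))"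
    by simp
  also have "\<dots> \<le> (\<Sum>i\<in>{1..n}. \<Sum>v\<in>truncated_at \<pi> i. \<delta> * real (degree E v))"
    using assms(2) by (intro sum_mono) (auto simp: good_def)
  also have "\<dots> = \<delta> * real (\<Sum>i\<in>{1..n}. \<Sum>v\<in>truncated_at \<pi> i. degree E v)"
    by (simp add: sum_distrib_left)
  also have "\<dots> \<le> \<delta> * real (2 * card (cut_edges \<pi>))"
    using sum_degree_truncated_le[OF assms(1)] assms(3)
    by (intro mult_left_mono) (simp_all only: of_nat_le_iff)
  finally show ?thesis by simp
qed

text \<open>The truncation cuts are bounded by a multiple of the cost of the same output, not of the
  optimum; this multiple is absorbed into the left-hand side.\<close>

lemma cost_good_le:
  assumes "\<pi> \<in> orderings V" "good \<delta> \<pi>" "0 \<le> \<delta>"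
  shows "(1 - 2 * \<delta>) * real (cost V E (truncated_pivot c \<epsilon> V E \<pi>)) \<le> real (card (charges \<pi>))"
proof -
  let ?D = "charged_pair ` charges \<pi>"
  have finT: "finite (truncation_cuts \<pi>)"
    unfolding truncation_cuts_def using finite_truncated_at finite_neighbors by blast
  have finD: "finite ?D" using finite_charges by blast
  \<comment> \<open>Splitting the charged pairs into edges and non-edges lets the two kinds of error
    draw on disjoint parts of one set of charges.\<close>
  have "cut_edges \<pi> \<subseteq> (?D \<inter> E) \<union> truncation_cuts \<pi>"
    using cut_edges_charged_or_truncated[OF assms(1)] by (auto simp: cut_edges_def)
  then have "card (cut_edges \<pi>) \<le> card ((?D \<inter> E) \<union> truncation_cuts \<pi>)"
    using finT finD by (intro card_mono) auto
  then have 1: "card (cut_edges \<pi>) \<le> card (?D \<inter> E) + card (truncation_cuts \<pi>)"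
    using card_Un_le le_trans by blast
  have "joined_nonedges \<pi> \<subseteq> ?D - E"
    using joined_nonedges_charged[OF assms(1)] by (auto simp: joined_nonedges_def)
  then have 2: "card (joined_nonedges \<pi>) \<le> card (?D - E)" using finD by (intro card_mono) auto
  have 3: "card (?D \<inter> E) + card (?D - E) \<le> card (charges \<pi>)"
    using card_Int_Diff[OF finD, of E] card_image_le[OF finite_charges, of charged_pair \<pi>] by simp
  have "cost V E (truncated_pivot c \<epsilon> V E \<pi>) \<le> card (charges \<pi>) + card (truncation_cuts \<pi>)"
    using 1 2 3 by (simp add: cost_eq)
  then have "real (cost V E (truncated_pivot c \<epsilon> V E \<pi>)) \<le>
      real (card (charges \<pi>)) + 2 * \<delta> * real (card (cut_edges \<pi>))"
    using card_truncation_cuts_le[OF assms] by linarith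
  also have "\<dots> \<le> real (card (charges \<pi>)) + 2 * \<delta> * real (cost V E (truncated_pivot c \<epsilon> V E \<pi>))"
    using assms(3) by (intro add_left_mono mult_left_mono) (auto simp: cost_eq)
  finally show ?thesis by (simp add: algebra_simps)
qed

lemma cost_le: "cost V E P \<le> n ^ 2"
proof -
  have "cost V E P \<le> card E + card (pairs V - E)"
    unfolding cost_def using finite_E finite_pairs by (intro add_mono card_mono) auto
  also have "\<dots> = card (pairs V)"
    using E_pairs finite_pairs finite_E by (simp add: card_Diff_subset card_mono)
  also have "\<dots> = n choose 2" unfolding pairs_def using n_subsets[OF finite_V] by simp
  also have "\<dots> \<le> n ^ 2" by (simp add: choose_two power2_eq_square order.trans[OF div_le_dividend])
  finally show ?thesis .
qed

section \<open>Active degrees\<close>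

text \<open>Exchanging positions composes on the left, which could move the default value taken
  outside \<open>V\<close>; \<open>restrict\<close> puts it back.\<close>

lemma swap_positions:
  assumes "\<pi> \<in> orderings V" "j \<in> {1..n}" "k \<in> {1..n}"
  shows "restrict (Transposition.transpose j k \<circ> \<pi>) V \<in> orderings V"
proof -
  have "bij_betw (Transposition.transpose j k) {1..n} {1..n}"
    using assms(2,3)
    by (intro bij_betwI[where g = "Transposition.transpose j k"]) (auto simp: Transposition.transpose_def)
  moreover have "bij_betw \<pi> V {1..n}" using assms(1) by (simp add: orderings_def)
  ultimately have "bij_betw (Transposition.transpose j k \<circ> \<pi>) V {1..n}" using bij_betw_trans by blast
  then have b: "bij_betw (restrict (Transposition.transpose j k \<circ> \<pi>) V) V {1..n}"
    by (simp cong: bij_betw_cong)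
  then show ?thesis using bij_betw_imp_funcset[OF b] by (simp add: orderings_def PiE_def)
qed

definition surviving :: "'a \<Rightarrow> real \<Rightarrow> nat \<Rightarrow> ('a \<Rightarrow> nat) set" where
  "surviving v d i =
     {\<pi> \<in> orderings V. v \<in> active \<pi> i \<and> d \<le> real (card (neighbors E v \<inter> active \<pi> i))}"

text \<open>The set of untruncated nodes at step \<open>k\<close> depends only on the first \<open>k - 1\<close> positions, so the
  node at position \<open>k\<close> hits it no less likely than the node at any later position does.\<close>

lemma card_surviving_Suc_le:
  assumes "Suc i \<le> n"
  shows "real (card (surviving v d (Suc i))) \<le> exp (- d / n) * real (card (surviving v d i))"
proof -
  let ?k = "Suc i"
  define S where "S \<pi> = neighbors E v \<inter> untruncated \<pi> ?k" for \<pi>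
  \<comment> \<open>\<open>H\<close> is the survival event halfway through the step, after
    truncation. \<open>T j\<close> adds that the node at position \<open>j\<close> is one of the
    remaining neighbors of \<open>v\<close>.\<close>
  define H where "H = {\<pi> \<in> orderings V. v \<in> untruncated \<pi> ?k \<and> d \<le> real (card (S \<pi>))}"
  define T where "T j = {\<pi> \<in> H. pivot_at \<pi> j \<in> S \<pi>}" for j
  have finO: "finite (orderings V)" using orderings_finite_nonempty(1)[OF finite_V] .
  have finH: "finite H" using finO by (simp add: H_def)
  have finS: "finite (S \<pi>)" for \<pi> by (simp add: S_def finite_neighbors)
  have TH: "T j \<subseteq> H" for j by (auto simp: T_def)
  have le: "card (T j) \<le> card (T ?k)" if j: "j \<in> {?k..n}" for j
  proof (rule card_inj_on_le[where f = "\<lambda>\<pi>. restrict (Transposition.transpose j ?k \<circ> \<pi>) V"])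
    let ?s = "\<lambda>\<pi>. restrict (Transposition.transpose j ?k \<circ> \<pi>) V"
    have jk: "j \<in> {1..n}" "?k \<in> {1..n}" using j assms by auto
    show "finite (T ?k)" using finH by (simp add: T_def)
    show "inj_on ?s (T j)"
    proof (rule inj_onI)
      fix f g assume fg: "f \<in> T j" "g \<in> T j" "?s f = ?s g"
      have ext: "f \<in> extensional V" "g \<in> extensional V"
        using fg(1,2) by (auto simp: T_def H_def orderings_def PiE_def)
      show "f = g"
      proof (rule extensionalityI[OF ext])
        fix x assume "x \<in> V"
        then have "Transposition.transpose j ?k (f x) = Transposition.transpose j ?k (g x)"
          using fun_cong[OF fg(3), of x] by simp
        then show "f x = g x" by (metis transpose_involutory)
      qed
    qed
    show "?s ` T j \<subseteq> T ?k"
    proof clarify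
      fix \<pi> assume "\<pi> \<in> T j"
      then have \<pi>: "\<pi> \<in> orderings V" "v \<in> untruncated \<pi> ?k" "d \<le> real (card (S \<pi>))"
        "pivot_at \<pi> j \<in> S \<pi>" by (auto simp: T_def H_def)
      have \<sigma>: "?s \<pi> \<in> orderings V" using swap_positions[OF \<pi>(1) jk] .
      have U: "untruncated (?s \<pi>) ?k = untruncated \<pi> ?k"
      proof (rule untruncated_cong[OF \<pi>(1) \<sigma>])
        show "?s \<pi> x = \<pi> x" if "x \<in> V" "\<pi> x < ?k" for x
          using that j by (auto simp: Transposition.transpose_def)
      qed (use assms in auto)
      have p: "pivot_at \<pi> j \<in> V" "\<pi> (pivot_at \<pi> j) = j" using pivot_at_in[OF \<pi>(1)] jk by auto
      then have "?s \<pi> (pivot_at \<pi> j) = ?k" by simp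
      then have "pivot_at (?s \<pi>) ?k = pivot_at \<pi> j" using orderingD(4)[OF \<sigma> p(1)] by metis
      then show "?s \<pi> \<in> T ?k" using \<sigma> \<pi> U by (simp add: T_def H_def S_def)
    qed
  qed
  \<comment> \<open>Averaging over positions: an ordering in \<open>H\<close> has at least
    \<open>d\<close> remaining neighbors of \<open>v\<close>, all at positions from
    \<open>?k\<close> on. As position \<open>?k\<close> is the likeliest of these to hold one,
    \<open>T ?k\<close> makes up at least a fraction \<open>d / n\<close> of
    \<open>H\<close>.\<close>
  have "d * real (card H) = (\<Sum>\<pi>\<in>H. d)" by simp
  also have "\<dots> \<le> (\<Sum>\<pi>\<in>H. real (card {j \<in> {?k..n}. pivot_at \<pi> j \<in> S \<pi>}))"
  proof (rule sum_mono)
    fix \<pi> assume "\<pi> \<in> H"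
    then have \<pi>: "\<pi> \<in> orderings V" "d \<le> real (card (S \<pi>))" by (auto simp: H_def)
    have SV: "S \<pi> \<subseteq> V" using untruncated_subset_V by (auto simp: S_def)
    have "card (S \<pi>) \<le> card {j \<in> {?k..n}. pivot_at \<pi> j \<in> S \<pi>}"
    proof (rule card_inj_on_le[where f = \<pi>])
      show "inj_on \<pi> (S \<pi>)" using orderingD(1)[OF \<pi>(1)] SV inj_on_subset by blast
      show "\<pi> ` S \<pi> \<subseteq> {j \<in> {?k..n}. pivot_at \<pi> j \<in> S \<pi>}"
      proof clarify
        fix x assume x: "x \<in> S \<pi>"
        then have "x \<in> active \<pi> i" using untruncated_subset[of \<pi> ?k] by (auto simp: S_def)
        then have "i < \<pi> x" by (rule active_position[OF \<pi>(1)])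
        moreover have "x \<in> V" using x SV by blast
        ultimately show "\<pi> x \<in> {?k..n} \<and> pivot_at \<pi> (\<pi> x) \<in> S \<pi>"
          using orderingD(3,4)[OF \<pi>(1)] x by auto
      qed
    qed simp
    then show "d \<le> real (card {j \<in> {?k..n}. pivot_at \<pi> j \<in> S \<pi>})" using \<pi>(2) by linarith
  qed
  also have "\<dots> = real (\<Sum>\<pi>\<in>H. card {j \<in> {?k..n}. pivot_at \<pi> j \<in> S \<pi>})" by simp
  also have "(\<Sum>\<pi>\<in>H. card {j \<in> {?k..n}. pivot_at \<pi> j \<in> S \<pi>}) = (\<Sum>j\<in>{?k..n}. card (T j))"
    by (rule sum_multicount_gen[OF finH]) (auto simp: T_def)
  also have "(\<Sum>j\<in>{?k..n}. card (T j)) \<le> (\<Sum>j\<in>{?k..n}. card (T ?k))" by (rule sum_mono) (rule le)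
  also have "\<dots> = (n - i) * card (T ?k)" by simp
  also have "\<dots> \<le> n * card (T ?k)" by simp
  finally have hit: "d * real (card H) \<le> real n * real (card (T ?k))" by simp
  have n0: "0 < real n" using assms by simp
  \<comment> \<open>If the pivot were a remaining neighbor of \<open>v\<close>, then
    \<open>v\<close> would join its cluster and become inactive.\<close>
  have sub: "surviving v d (Suc i) \<subseteq> H - T ?k"
  proof
    fix \<pi> assume "\<pi> \<in> surviving v d (Suc i)"
    then have \<pi>: "\<pi> \<in> orderings V" "v \<in> active \<pi> ?k"
      "d \<le> real (card (neighbors E v \<inter> active \<pi> ?k))" by (auto simp: surviving_def)
    have v: "v \<in> untruncated \<pi> ?k" using \<pi>(2) active_Suc_subset by blast
    have "card (neighbors E v \<inter> active \<pi> ?k) \<le> card (S \<pi>)"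
      using finS active_Suc_subset by (intro card_mono) (auto simp: S_def)
    then have "\<pi> \<in> H" using \<pi> v by (simp add: H_def)
    moreover have "pivot_at \<pi> ?k \<notin> S \<pi>"
    proof
      assume a: "pivot_at \<pi> ?k \<in> S \<pi>"
      then have "v \<in> pivot_cluster \<pi> ?k"
        using v neighbors_commute by (auto simp: S_def pivot_cluster_def)
      then show False using \<pi>(2) a by (auto simp: active_Suc S_def)
    qed
    ultimately show "\<pi> \<in> H - T ?k" by (simp add: T_def)
  qed
  have "H \<subseteq> surviving v d i"
  proof
    fix \<pi> assume "\<pi> \<in> H"
    then have \<pi>: "\<pi> \<in> orderings V" "v \<in> untruncated \<pi> ?k" "d \<le> real (card (S \<pi>))"
      by (auto simp: H_def)
    have U: "untruncated \<pi> ?k \<subseteq> active \<pi> i" using untruncated_subset[of \<pi> ?k] by simp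
    then have "card (S \<pi>) \<le> card (neighbors E v \<inter> active \<pi> i)"
      using finite_neighbors by (intro card_mono) (auto simp: S_def)
    then show "\<pi> \<in> surviving v d i" using \<pi> U by (auto simp: surviving_def)
  qed
  then have HG: "card H \<le> card (surviving v d i)"
    using finO by (intro card_mono) (auto simp: surviving_def)
  have "card (surviving v d (Suc i)) \<le> card (H - T ?k)" using sub finH by (intro card_mono) auto
  also have "\<dots> = card H - card (T ?k)" using card_Diff_subset[OF finite_subset[OF TH finH] TH] .
  finally have "real (card (surviving v d (Suc i))) \<le> real (card H) - real (card (T ?k))"
    using card_mono[OF finH TH[of ?k]] by linarith
  also have "\<dots> \<le> (1 + - d / n) * real (card H)"
    using hit n0 by (simp add: field_simps)
  also have "\<dots> \<le> exp (- d / n) * real (card H)"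
    by (intro mult_right_mono exp_ge_add_one_self) simp
  also have "\<dots> \<le> exp (- d / n) * real (card (surviving v d i))"
    using HG by (intro mult_left_mono) auto
  finally show ?thesis .
qed

lemma card_surviving_le:
  assumes "i \<le> n"
  shows "real (card (surviving v d i)) \<le> exp (- (real i * d / n)) * real (card (orderings V))"
  using assms
proof (induction i)
  case 0
  have "card (surviving v d 0) \<le> card (orderings V)"
    using orderings_finite_nonempty(1)[OF finite_V] by (intro card_mono) (auto simp: surviving_def)
  then show ?case by simp
next
  case (Suc i)
  have "real (card (surviving v d (Suc i))) \<le> exp (- d / n) * real (card (surviving v d i))"
    using card_surviving_Suc_le Suc.prems by blast
  also have "\<dots> \<le> exp (- d / n) * (exp (- (real i * d / n)) * real (card (orderings V)))"
    using Suc by (intro mult_left_mono) auto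
  also have "\<dots> = exp (- (real (Suc i) * d / n)) * real (card (orderings V))"
  proof -
    have "- (real (Suc i) * d / n) = - d / n + - (real i * d / n)"
      by (simp add: add_divide_distrib distrib_right)
    then show ?thesis by (simp only: exp_add mult.assoc)
  qed
  finally show ?case .
qed

section \<open>Exceptional orderings are rare\<close>

lemma truncated_atD:
  assumes "v \<in> truncated_at \<pi> i"
  shows "v \<in> active \<pi> (i - 1)" "cutoff i \<le> real (degree E v)"
  using assms by (auto simp: truncated_at_def untruncated_def)

lemma good_if_cutoffs_large:
  assumes "\<And>i. i \<in> {1..n} \<Longrightarrow> real n < cutoff i"
  shows "good \<delta> \<pi>"
proof -
  have "truncated_at \<pi> i = {}" if "i \<in> {1..n}" for i
  proof (rule equals0I)
    fix v assume "v \<in> truncated_at \<pi> i"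
    then have "cutoff i \<le> real (degree E v)" by (rule truncated_atD)
    then show False using assms[OF that] degree_le[of v] by linarith
  qed
  then show ?thesis by (simp add: good_def)
qed

text \<open>A union bound over the \<open>n ^ 2\<close> choices of step and node, each failing with
  probability at most \<open>1 / n ^ 6\<close>. No pivot precedes step 1, so that step is excluded
  by the assumption on \<open>cutoff 1\<close>.\<close>

lemma card_not_good_le:
  assumes "0 < c" "0 < \<epsilon>" "0 < n" "real n < cutoff 1"
  shows "real (card {\<pi> \<in> orderings V. \<not> good (12 * \<epsilon> / c) \<pi>}) \<le> real (card (orderings V)) / real n ^ 4"
proof -
  define \<delta> where "\<delta> = 12 * \<epsilon> / c"
  have \<delta>: "0 < \<delta>" using assms by (simp add: \<delta>_def)
  define F where "F i v = {\<pi> \<in> orderings V. v \<in> truncated_at \<pi> i \<and>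
    \<delta> * real (degree E v) < real (card (neighbors E v \<inter> active \<pi> (i - 1)))}" for i v
  have finO: "finite (orderings V)" using orderings_finite_nonempty(1)[OF finite_V] .
  have finF: "finite (F i v)" for i v using finO by (simp add: F_def)
  have F: "real (card (F i v)) \<le> real (card (orderings V)) / real n ^ 6" if i: "i \<in> {1..n}" for i v
  proof (cases "F i v = {}")
    case True
    then show ?thesis by simp
  next
    case False
    \<comment> \<open>Degrees and cutoffs do not depend on the ordering, so a single ordering in the
      event yields this inequality.\<close>
    then have deg: "cutoff i \<le> real (degree E v)" using truncated_atD(2) by (auto simp: F_def)
    then have "i \<noteq> 1" using degree_le[of v] assms(4) by auto
    then have i2: "2 \<le> i" using i by simp
    have "\<delta> * cutoff i = 12 * (real n * ln (real n) / real i)"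
      using assms(1,2) by (simp add: \<delta>_def threshold_def)
    then have "12 * (real n * ln (real n) / real i) \<le> \<delta> * real (degree E v)"
      using deg \<delta> by (metis mult_le_cancel_left_pos)
    then have "real (i - 1) / real n * (12 * (real n * ln (real n) / real i)) \<le>
        real (i - 1) / real n * (\<delta> * real (degree E v))"
      by (intro mult_left_mono) auto
    moreover have "real (i - 1) / real n * (12 * (real n * ln (real n) / real i)) =
        12 * (real (i - 1) / real i) * ln (real n)" using assms(3) by simp
    \<comment> \<open>Only \<open>i - 1\<close> steps precede the truncation; for
      \<open>i \<ge> 2\<close> the ratio \<open>(i - 1) / i\<close> is at least one half, which
      turns 12 into 6.\<close>
    moreover have "6 * ln (real n) \<le> 12 * (real (i - 1) / real i) * ln (real n)"
      using i2 assms(3) by (intro mult_right_mono) (auto simp: field_simps of_nat_diff)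
    ultimately have ex: "6 * ln (real n) \<le> real (i - 1) / real n * (\<delta> * real (degree E v))" by linarith
    have "F i v \<subseteq> surviving v (\<delta> * real (degree E v)) (i - 1)"
      using truncated_atD(1) by (auto simp: F_def surviving_def)
    then have "card (F i v) \<le> card (surviving v (\<delta> * real (degree E v)) (i - 1))"
      using finO by (intro card_mono) (auto simp: surviving_def)
    moreover have "i - 1 \<le> n" using i by auto
    ultimately have "real (card (F i v)) \<le>
        exp (- (real (i - 1) / real n * (\<delta> * real (degree E v)))) * real (card (orderings V))"
      using card_surviving_le[of "i - 1" v "\<delta> * real (degree E v)"] by simp
    also have "\<dots> \<le> exp (- (6 * ln (real n))) * real (card (orderings V))"
      using ex by (intro mult_right_mono) auto
    also have "exp (- (6 * ln (real n))) = 1 / real n ^ 6"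
      using assms(3) exp_of_nat_mult[of 6 "ln (real n)"] by (simp add: exp_minus field_simps)
    finally show ?thesis by simp
  qed
  have "{\<pi> \<in> orderings V. \<not> good \<delta> \<pi>} \<subseteq> (\<Union>i\<in>{1..n}. \<Union>v\<in>V. F i v)"
    using active_subset by (fastforce simp: good_def F_def not_le truncated_at_def)
  then have "card {\<pi> \<in> orderings V. \<not> good \<delta> \<pi>} \<le> card (\<Union>i\<in>{1..n}. \<Union>v\<in>V. F i v)"
    using finF finite_V by (intro card_mono) auto
  also have "\<dots> \<le> (\<Sum>i\<in>{1..n}. card (\<Union>v\<in>V. F i v))" by (rule card_UN_le) simp
  also have "\<dots> \<le> (\<Sum>i\<in>{1..n}. \<Sum>v\<in>V. card (F i v))" by (intro sum_mono card_UN_le finite_V)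
  finally have "real (card {\<pi> \<in> orderings V. \<not> good \<delta> \<pi>}) \<le> real (\<Sum>i\<in>{1..n}. \<Sum>v\<in>V. card (F i v))"
    by (simp only: of_nat_le_iff)
  also have "\<dots> = (\<Sum>i\<in>{1..n}. \<Sum>v\<in>V. real (card (F i v)))" by simp
  also have "\<dots> \<le> (\<Sum>i\<in>{1..n}. \<Sum>v\<in>V. real (card (orderings V)) / real n ^ 6)"
    by (intro sum_mono F)
  also have "\<dots> = real (card (orderings V)) / real n ^ 4"
    using assms(3) by (simp add: field_simps power_numeral_reduce)
  finally show ?thesis by (simp add: \<delta>_def)
qed

text \<open>Averages a pointwise bound: scaled charges on good orderings, and the crude bound
  \<open>n ^ 2\<close> on the cost for the others.\<close>

lemma expected_cost_le:
  assumes "0 \<le> \<delta>" "2 * \<delta> < 1"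
  shows "expected_cost c \<epsilon> V E \<le> 3 * real (OPT V E) / (1 - 2 * \<delta>) +
    real n ^ 2 * real (card {\<pi> \<in> orderings V. \<not> good \<delta> \<pi>}) / real (card (orderings V))"
proof -
  let ?N = "real (card (orderings V))"
  let ?cost = "\<lambda>\<pi>. real (cost V E (truncated_pivot c \<epsilon> V E \<pi>))"
  let ?B = "{\<pi> \<in> orderings V. \<not> good \<delta> \<pi>}"
  note O = orderings_finite_nonempty[OF finite_V]
  have N: "0 < ?N" using O by (simp add: card_gt_0_iff)
  have "?cost \<pi> \<le> real (card (charges \<pi>)) / (1 - 2 * \<delta>) + real n ^ 2 * (if good \<delta> \<pi> then 0 else 1)"
    if "\<pi> \<in> orderings V" for \<pi>
  proof (cases "good \<delta> \<pi>")
    case True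
    then show ?thesis using cost_good_le[OF that True assms(1)] assms(2) by (simp add: field_simps)
  next
    case False
    have "?cost \<pi> \<le> real n ^ 2" using cost_le[of "truncated_pivot c \<epsilon> V E \<pi>"]
      by (metis of_nat_le_iff of_nat_power)
    moreover have "0 \<le> real (card (charges \<pi>)) / (1 - 2 * \<delta>)" using assms by simp
    ultimately show ?thesis using False by (simp only: if_False)
  qed
  then have "(\<Sum>\<pi>\<in>orderings V. ?cost \<pi>) \<le> (\<Sum>\<pi>\<in>orderings V.
      real (card (charges \<pi>)) / (1 - 2 * \<delta>) + real n ^ 2 * (if good \<delta> \<pi> then 0 else 1))"
    by (rule sum_mono)
  also have "\<dots> = real (\<Sum>\<pi>\<in>orderings V. card (charges \<pi>)) / (1 - 2 * \<delta>) +
      real n ^ 2 * (\<Sum>\<pi>\<in>orderings V. if good \<delta> \<pi> then 0 else 1)"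
    by (simp add: sum.distrib sum_divide_distrib sum_distrib_left)
  also have "(\<Sum>\<pi>\<in>orderings V. if good \<delta> \<pi> then 0 else 1 :: real) = real (card ?B)"
  proof -
    have "(\<Sum>\<pi>\<in>orderings V. if good \<delta> \<pi> then 0 else 1 :: real) =
        (\<Sum>\<pi>\<in>orderings V. if \<not> good \<delta> \<pi> then 1 else 0)" by (intro sum.cong) auto
    also have "\<dots> = (\<Sum>\<pi>\<in>?B. 1)" using O(1) by (intro sum.inter_filter[symmetric])
    finally show ?thesis by simp
  qed
  also have "real (\<Sum>\<pi>\<in>orderings V. card (charges \<pi>)) / (1 - 2 * \<delta>) \<le>
      real (3 * (card (orderings V) * OPT V E)) / (1 - 2 * \<delta>)"
    using assms(2) sum_card_charges_le by (intro divide_right_mono of_nat_mono) auto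
  finally have "(\<Sum>\<pi>\<in>orderings V. ?cost \<pi>) / ?N \<le>
      (real (3 * (card (orderings V) * OPT V E)) / (1 - 2 * \<delta>) + real n ^ 2 * real (card ?B)) / ?N"
    using N by (intro divide_right_mono) auto
  also have "\<dots> = 3 * real (OPT V E) / (1 - 2 * \<delta>) + real n ^ 2 * real (card ?B) / ?N"
    using N by (simp add: add_divide_distrib)
  finally show ?thesis
    unfolding expected_cost_def using O by (simp add: integral_pmf_of_set)
qed

end

section \<open>The approximation guarantee\<close>

text \<open>Used in contrapositive form: a positive optimum forces two nodes, which keeps
  \<open>ln n\<close> away from zero.\<close>

lemma OPT_eq_0_if_card_le_1:
  assumes "simple_graph V E" "card V \<le> 1"
  shows "OPT V E = 0"
proof -
  have fin: "finite V" and E: "E \<subseteq> pairs V" using assms(1) by (auto simp: simple_graph_def)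
  have "card e \<le> 1" if "e \<subseteq> V" for e using card_mono[OF fin that] assms(2) by simp
  then have "card e \<noteq> 2" if "e \<subseteq> V" for e using that by (metis Suc_1 Suc_n_not_le_n)
  then have "pairs V = {}" by (auto simp: pairs_def)
  then have "cost V E P = 0" for P using E by (simp add: cost_def)
  then show ?thesis using OPT_attained[OF fin, of E] by fastforce
qed

theorem theorem3:
  "\<exists>c>0. \<forall>\<epsilon>::real. 0 < \<epsilon> \<and> \<epsilon> < 1/4 \<longrightarrow>
     (\<forall>(V :: 'a set) E. simple_graph V E \<and> OPT V E > 0 \<longrightarrow>
        expected_cost c \<epsilon> V E \<le> (3 + \<epsilon>) * real (OPT V E))"
proof (intro exI[of _ 288] conjI allI impI)
  \<comment> \<open>With \<open>c = 288\<close> the fraction \<open>12 * \<epsilon> / c\<close> is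
    \<open>\<epsilon> / 24\<close>, so truncation costs only a factor
    \<open>1 / (1 - \<epsilon> / 12)\<close>.\<close>
  show "(0::real) < 288" by simp
  fix \<epsilon> :: real and V :: "'a set" and E
  assume "0 < \<epsilon> \<and> \<epsilon> < 1/4" and g: "simple_graph V E \<and> OPT V E > 0"
  then have \<epsilon>: "0 < \<epsilon>" "\<epsilon> < 1/4" by auto
  interpret clustering_instance 288 \<epsilon> V E by unfold_locales (use g in simp)
  let ?N = "real (card (orderings V))"
  let ?B = "{\<pi> \<in> orderings V. \<not> good (\<epsilon> / 24) \<pi>}"
  have N: "0 < ?N" using orderings_finite_nonempty[OF finite_V] by (simp add: card_gt_0_iff)
  have n2: "2 \<le> n" using OPT_eq_0_if_card_le_1[of V E] g by fastforce
  have OPT: "1 \<le> real (OPT V E)" using g by simp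
  have "ln 2 \<le> ln (real n)" using n2 by simp
  then have ln: "1/2 \<le> ln (real n)" using ln2_ge_two_thirds by linarith
  have rare: "real n ^ 2 * real (card ?B) / ?N \<le> \<epsilon> / 2"
  \<comment> \<open>For \<open>\<epsilon> \<le> 1 / n\<close> every cutoff exceeds \<open>n\<close>
    and nothing is truncated. Otherwise the contribution \<open>1 / n ^ 2\<close> is at most
    \<open>\<epsilon> / 2\<close>, bounding one factor \<open>1 / n\<close> by
    \<open>\<epsilon>\<close> and the other by one half.\<close>
  proof (cases "\<epsilon> \<le> 1 / n")
    case True
    have "real n < cutoff i" if i: "i \<in> {1..n}" for i
    proof -
      have "real n < 144 * real n" using n2 by simp
      also have "\<dots> \<le> 288 / \<epsilon> * (1/2)" using True \<epsilon>(1) n2 by (simp add: field_simps)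
      also have "\<dots> \<le> 288 / \<epsilon> * (real n * ln (real n) / real i)"
      proof (intro mult_left_mono)
        have "1/2 * real i \<le> real n * ln (real n)"
          using ln i mult_mono[of "1/2" "ln (real n)" "real i" "real n"] by (simp add: mult.commute)
        then show "1/2 \<le> real n * ln (real n) / real i" using i by (simp add: field_simps)
      qed (use \<epsilon> in auto)
      finally show ?thesis by (simp add: threshold_def)
    qed
    then have "?B = {}" using good_if_cutoffs_large by blast
    then show ?thesis using \<epsilon>(1) by (simp only: card.empty)
  next
    case False
    have "real n < 288 / \<epsilon> * (real n * ln (real n))"
    proof -
      have "real n < 4 * real n" using n2 by simp
      also have "\<dots> \<le> 8 * (real n * ln (real n))" using ln n2 by (simp add: field_simps)
      also have "\<dots> \<le> 288 / \<epsilon> * (real n * ln (real n))"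
        using \<epsilon> ln by (intro mult_right_mono) (auto simp: field_simps)
      finally show ?thesis .
    qed
    then have "real n < cutoff 1" by (simp add: threshold_def)
    then have "real (card ?B) \<le> ?N / real n ^ 4"
      using card_not_good_le \<epsilon> n2 by simp
    then have "real n ^ 2 * real (card ?B) / ?N \<le> real n ^ 2 * (?N / real n ^ 4) / ?N"
      using N by (intro divide_right_mono mult_left_mono) auto
    also have "\<dots> = 1 / real n * (1 / real n)" using N n2 by (simp add: field_simps power_numeral_reduce)
    also have "\<dots> \<le> \<epsilon> * (1 / 2)" using False \<epsilon> n2 by (intro mult_mono) (auto simp: field_simps)
    finally show ?thesis by simp
  qed
  have "expected_cost 288 \<epsilon> V E \<le> 3 * real (OPT V E) / (1 - 2 * (\<epsilon> / 24)) + \<epsilon> / 2"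
    using expected_cost_le[of "\<epsilon> / 24"] rare \<epsilon> by linarith
  moreover have "3 * real (OPT V E) / (1 - 2 * (\<epsilon> / 24)) \<le> (3 + \<epsilon> / 2) * real (OPT V E)"
  proof -
    \<comment> \<open>The product below expands to
      \<open>3 + \<epsilon> / 4 - \<epsilon> * \<epsilon> / 24\<close>.\<close>
    have "\<epsilon> * \<epsilon> \<le> \<epsilon> * (1/4)" using \<epsilon> by (intro mult_left_mono) auto
    then have "3 \<le> (3 + \<epsilon> / 2) * (1 - 2 * (\<epsilon> / 24))" using \<epsilon> by (simp add: algebra_simps)
    then have "3 * real (OPT V E) \<le> (3 + \<epsilon> / 2) * (1 - 2 * (\<epsilon> / 24)) * real (OPT V E)"
      by (intro mult_right_mono) auto
    then show ?thesis using \<epsilon> by (simp add: divide_le_eq mult_ac)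
  qed
  \<comment> \<open>The optimum is a positive integer, so the additive error of the exceptional case
    becomes multiplicative.\<close>
  moreover have "\<epsilon> / 2 \<le> \<epsilon> / 2 * real (OPT V E)" using OPT \<epsilon> by simp
  moreover have "(3 + \<epsilon>) * real (OPT V E) = (3 + \<epsilon> / 2) * real (OPT V E) + \<epsilon> / 2 * real (OPT V E)"
    by (simp add: algebra_simps)
  ultimately show "expected_cost 288 \<epsilon> V E \<le> (3 + \<epsilon>) * real (OPT V E)" by linarith
qed

end
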